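(* All unit-interval simplicial complexes are skeleton-E-chordal. All interval (also called underclosed) simplicial complexes are skeleton-weakly-chordal.
   Context: Simplicial complexes are finite and not necessarily pure. A vertex labeling of a complex with $n$ vertices is a bijection of its vertices with $[n]=\{1,\dots,n\}$; $\min F,\max F$ denote the smallest and largest labels in $F$; the size of a face is its number of vertices. For sets $G=\{g_0<\dots<g_k\}$, $F=\{f_0<\dots<f_k\}$ of the same size, $G\le F$ componentwise means $g_i\le f_i$ for all $i$. A complex $\Delta$ with $n$ vertices is: - unit-interval, if it has a labeling such that for every facet $F$ of $\Delta$, every subset of $\{\min F,\min F+1,\dots,\max F\}$ of size $|F|$ is a face of $\Delta$; - underclosed (or interval), if it has a labeling such that for every facet $F$ of $\Delta$ and every $G\subseteq[n]$ with $|G|=|F|$, if $\min G=\min F$ and $G\le F$ componentwise, then $G\in\Delta$; - skeleton-E-chordal, if it has a labeling such that for every two faces $f\ne g$ of $\Delta$ with the same size and same maximum, every subset $h\subseteq f\cup g$ with $|h|=|f|$ is a face of $\Delta$; - skeleton-weakly-chordal, if it has a labeling such that for every two faces $f\neq g$ of $\Delta$ with the same size and same maximum, $\Delta$ contains some face $h$ with $|h|=|f|$ and $h\subseteq (f\cup g)\setminus\{\max f\}$. *)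

theory Defs
  imports Main
begin

text \<open>A complex is given by its set of faces. The vertices are the elements lying in some face,
  so by heredity every vertex spans a face. Neither the empty face nor purity is required.\<close>

definition abstract_simplicial_complex :: "'a set set \<Rightarrow> bool" where
  "abstract_simplicial_complex \<Delta> \<longleftrightarrow>
     finite (\<Union>\<Delta>) \<and> (\<forall>F\<in>\<Delta>. \<forall>G. G \<subseteq> F \<longrightarrow> G \<in> \<Delta>)"

definition vertices :: "'a set set \<Rightarrow> 'a set" where
  "vertices \<Delta> = \<Union>\<Delta>"

definition facet :: "'a set set \<Rightarrow> 'a set \<Rightarrow> bool" where
  "facet \<Delta> F \<longleftrightarrow> F \<in> \<Delta> \<and> (\<forall>G\<in>\<Delta>. F \<subseteq> G \<longrightarrow> G = F)"

definition vertex_labeling :: "'a set set \<Rightarrow> ('a \<Rightarrow> nat) \<Rightarrow> bool" where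
  "vertex_labeling \<Delta> l \<longleftrightarrow> bij_betw l (vertices \<Delta>) {1..card (vertices \<Delta>)}"

text \<open>The complex on the label set obtained by replacing every vertex by its label.\<close>

definition relabel :: "('a \<Rightarrow> nat) \<Rightarrow> 'a set set \<Rightarrow> nat set set" where
  "relabel l \<Delta> = (\<lambda>F. l ` F) ` \<Delta>"

text \<open>Componentwise order on finite sets of labels; it forces equal cardinality.\<close>

definition componentwise_le :: "nat set \<Rightarrow> nat set \<Rightarrow> bool" where
  "componentwise_le G F \<longleftrightarrow> list_all2 (\<le>) (sorted_list_of_set G) (sorted_list_of_set F)"

text \<open>In the definitions below, \<open>Min {}\<close> and \<open>Max {}\<close> are unspecified, but harmless. The empty set
  is a facet only of the complex \<open>{{}}\<close>, and it is then its only subset of size 0; distinct finite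
  sets of equal size are nonempty.\<close>

definition unit_interval_complex :: "'a set set \<Rightarrow> bool" where
  "unit_interval_complex \<Delta> \<longleftrightarrow>
     (\<exists>l. vertex_labeling \<Delta> l \<and>
       (\<forall>F. facet (relabel l \<Delta>) F \<longrightarrow>
         (\<forall>G. G \<subseteq> {Min F..Max F} \<and> card G = card F \<longrightarrow> G \<in> relabel l \<Delta>)))"

definition underclosed_complex :: "'a set set \<Rightarrow> bool" where
  "underclosed_complex \<Delta> \<longleftrightarrow>
     (\<exists>l. vertex_labeling \<Delta> l \<and>
       (\<forall>F. facet (relabel l \<Delta>) F \<longrightarrow>
         (\<forall>G. G \<subseteq> {1..card (vertices \<Delta>)} \<and> card G = card F \<and>
              Min G = Min F \<and> componentwise_le G F \<longrightarrow> G \<in> relabel l \<Delta>)))"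

definition skeleton_E_chordal :: "'a set set \<Rightarrow> bool" where
  "skeleton_E_chordal \<Delta> \<longleftrightarrow>
     (\<exists>l. vertex_labeling \<Delta> l \<and>
       (\<forall>f\<in>relabel l \<Delta>. \<forall>g\<in>relabel l \<Delta>.
         f \<noteq> g \<and> card f = card g \<and> Max f = Max g \<longrightarrow>
         (\<forall>h. h \<subseteq> f \<union> g \<and> card h = card f \<longrightarrow> h \<in> relabel l \<Delta>)))"

definition skeleton_weakly_chordal :: "'a set set \<Rightarrow> bool" where
  "skeleton_weakly_chordal \<Delta> \<longleftrightarrow>
     (\<exists>l. vertex_labeling \<Delta> l \<and>
       (\<forall>f\<in>relabel l \<Delta>. \<forall>g\<in>relabel l \<Delta>.
         f \<noteq> g \<and> card f = card g \<and> Max f = Max g \<longrightarrow>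
         (\<exists>h\<in>relabel l \<Delta>. card h = card f \<and> h \<subseteq> (f \<union> g) - {Max f})))"

end

theory Submission
  imports Defs
begin

text \<open>Any labeling witnessing the hypothesis also witnesses the conclusion. Let \<open>f \<noteq> g\<close> be faces of
  equal size with common maximum \<open>m\<close>, where \<open>Min f \<le> Min g\<close>, and let \<open>F\<close> be a facet containing
  \<open>f\<close>. In the unit-interval case \<open>f \<union> g \<subseteq> {Min F..Max F}\<close>, so every \<open>h \<subseteq> f \<union> g\<close> of size \<open>card f\<close>
  extends inside this interval to a set of size \<open>card F\<close>, which is a face. In the underclosed case
  pick \<open>x \<in> g - f\<close>; then \<open>Min F < x < m\<close>, so exchanging \<open>m\<close> for \<open>x\<close> in \<open>F\<close> keeps the minimum and
  decreases \<open>F\<close> componentwise, and \<open>h = insert x (f - {m})\<close> is a face.\<close>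

text \<open>Every subset of the image of a face is the image of a subset of that face, so heredity
  passes to the labels and the argument can be carried out on sets of naturals.\<close>

lemma abstract_simplicial_complex_relabel:
  assumes "abstract_simplicial_complex \<Delta>"
  shows "abstract_simplicial_complex (relabel l \<Delta>)"
  unfolding abstract_simplicial_complex_def
proof (intro conjI ballI allI impI)
  have "\<Union> (relabel l \<Delta>) = l ` \<Union>\<Delta>"
    by (auto simp: relabel_def)
  then show "finite (\<Union> (relabel l \<Delta>))"
    using assms by (simp add: abstract_simplicial_complex_def)
next
  fix F G assume "F \<in> relabel l \<Delta>" "G \<subseteq> F"
  then obtain F' where "F' \<in> \<Delta>" "G \<subseteq> l ` F'"
    by (auto simp: relabel_def)
  then obtain G' where "G' \<subseteq> F'" "G = l ` G'"
    by (auto simp: subset_image_iff)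
  with \<open>F' \<in> \<Delta>\<close> show "G \<in> relabel l \<Delta>"
    using assms by (auto simp: abstract_simplicial_complex_def relabel_def)
qed

lemma relabel_subset_labels:
  assumes "vertex_labeling \<Delta> l" "F \<in> relabel l \<Delta>"
  shows "F \<subseteq> {1..card (vertices \<Delta>)}"
proof -
  have "F \<subseteq> l ` vertices \<Delta>"
    using assms(2) by (auto simp: relabel_def vertices_def)
  then show ?thesis
    using assms(1) by (simp add: vertex_labeling_def bij_betw_def)
qed

lemma face_subset:
  "abstract_simplicial_complex K \<Longrightarrow> F \<in> K \<Longrightarrow> G \<subseteq> F \<Longrightarrow> G \<in> K"
  by (auto simp: abstract_simplicial_complex_def)

lemma finite_face:
  "abstract_simplicial_complex K \<Longrightarrow> F \<in> K \<Longrightarrow> finite F"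
  by (auto simp: abstract_simplicial_complex_def intro: finite_subset[OF Union_upper])

text \<open>Both hypotheses on labelings concern facets only; this is the bridge from them to
  arbitrary faces.\<close>

lemma ex_facet_superset:
  assumes "abstract_simplicial_complex K" "f \<in> K"
  obtains F where "facet K F" "f \<subseteq> F"
proof -
  have "finite K"
    using assms(1) by (simp add: abstract_simplicial_complex_def finite_UnionD)
  from finite_has_maximal2[OF this assms(2)] obtain F
    where "F \<in> K" "f \<subseteq> F" "\<forall>G\<in>K. F \<subseteq> G \<longrightarrow> F = G"
    by auto
  then show thesis
    using that[of F] by (auto simp: facet_def)
qed

lemma list_all2_insort:
  fixes x y :: "'a::linorder"
  assumes "sorted xs" "x \<le> y"
  shows "list_all2 (\<le>) (insort x xs) (insort y xs)"
  using assms
proof (induction xs arbitrary: x)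
  case Nil
  then show ?case by simp
next
  case (Cons z zs)
  have refl: "list_all2 (\<le>) zs zs"
    by (simp add: list_all2_refl)
  \<comment> \<open>This settles the case \<open>x \<le> z < y\<close>, where
    \<open>x # z # zs\<close> faces \<open>z # insort y zs\<close>: the tails compare by the
    induction hypothesis with \<open>z\<close> in place of \<open>x\<close>, which is why
    \<open>x\<close> is arbitrary.\<close>
  have "list_all2 (\<le>) (insort z zs) (insort y zs)" if "z \<le> y"
    using Cons that by auto
  moreover have "insort z zs = z # zs"
    using Cons.prems(1) by (simp add: insort_is_Cons)
  ultimately show ?case
    using Cons refl by auto
qed

text \<open>Both sorted lists arise from that of \<open>F - {m}\<close> by inserting one element,
  \<open>x\<close> or \<open>m\<close>.\<close>

lemma componentwise_le_exchange:
  assumes "finite F" "m \<in> F" "x \<notin> F" "x \<le> m"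
  shows "componentwise_le (insert x (F - {m})) F"
proof -
  have "sorted_list_of_set F = insort m (sorted_list_of_set (F - {m}))"
    using sorted_list_of_set_insert[of "F - {m}" m] assms(1,2) by (simp add: insert_absorb)
  moreover have "sorted_list_of_set (insert x (F - {m})) = insort x (sorted_list_of_set (F - {m}))"
    using assms by simp
  ultimately show ?thesis
    using assms(4) by (simp add: componentwise_le_def list_all2_insort)
qed

lemma card_insert_Diff_eq:
  assumes "finite F" "m \<in> F" "x \<notin> F"
  shows "card (insert x (F - {m})) = card F"
  using assms card.remove[of F m] by simp

text \<open>If one set were empty, equal cardinality would make both empty. Hence \<open>Min\<close>
  and \<open>Max\<close> of two such faces are attained.\<close>

lemma nonempty_if_neq_card_eq:
  assumes "finite f" "finite g" "f \<noteq> g" "card f = card g"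
  shows "f \<noteq> {}" "g \<noteq> {}"
  using assms by auto

lemma unit_interval_faces:
  fixes f g :: "nat set"
  assumes K: "abstract_simplicial_complex K"
    and interval: "\<forall>F. facet K F \<longrightarrow> (\<forall>G. G \<subseteq> {Min F..Max F} \<and> card G = card F \<longrightarrow> G \<in> K)"
    and fg: "f \<in> K" "g \<in> K" "f \<noteq> g" "card f = card g" "Max f = Max g" "Min f \<le> Min g"
    and h: "h \<subseteq> f \<union> g" "card h = card f"
  shows "h \<in> K"
proof -
  have fin: "finite f" "finite g"
    using K fg finite_face by auto
  obtain F where F: "facet K F" "f \<subseteq> F"
    using ex_facet_superset[OF K fg(1)] .
  have finF: "finite F"
    using K F(1) finite_face by (auto simp: facet_def)
  have "f \<noteq> {}"
    using nonempty_if_neq_card_eq fin fg by blast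
  then have "Min F \<le> Min f" "Max f \<le> Max F"
    using F(2) finF by (auto intro: Min_antimono Max_mono)
  moreover have "f \<union> g \<subseteq> {Min f..Max f}"
  proof
    fix x assume "x \<in> f \<union> g"
    then show "x \<in> {Min f..Max f}"
    proof
      assume "x \<in> f"
      then show ?thesis using fin(1) by simp
    next
      assume "x \<in> g"
      then have "Min g \<le> x" "x \<le> Max g" using fin(2) by simp_all
      then show ?thesis using fg(5,6) by simp
    qed
  qed
  ultimately have "f \<union> g \<subseteq> {Min F..Max F}"
    by (meson atLeastatMost_subset_iff order_trans)
  then have "h \<subseteq> {Min F..Max F}"
    using h(1) by blast
  \<comment> \<open>The interval thus has at least \<open>card F\<close> elements, which leaves room
    to enlarge \<open>h\<close> to that size.\<close>
  moreover have "F \<subseteq> {Min F..Max F}"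
    using finF by auto
  then have "card F \<le> card {Min F..Max F}"
    by (intro card_mono) auto
  moreover have "card h \<le> card F"
    using h(2) F(2) finF by (simp add: card_mono)
  ultimately obtain H where H: "h \<subseteq> H" "H \<subseteq> {Min F..Max F}" "card H = card F"
    using exists_subset_between[of h "card F" "{Min F..Max F}"] by auto
  then show ?thesis
    using interval F(1) face_subset[OF K] by blast
qed

lemma underclosed_exchange_face:
  fixes f g :: "nat set"
  assumes K: "abstract_simplicial_complex K" "\<Union>K \<subseteq> V"
    and underclosed: "\<forall>F. facet K F \<longrightarrow> (\<forall>G. G \<subseteq> V \<and> card G = card F \<and>
        Min G = Min F \<and> componentwise_le G F \<longrightarrow> G \<in> K)"
    and fg: "f \<in> K" "g \<in> K" "f \<noteq> g" "card f = card g" "Max f = Max g" "Min f \<le> Min g"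
  shows "\<exists>h\<in>K. card h = card f \<and> h \<subseteq> (f \<union> g) - {Max f}"
proof -
  define m where "m = Max f"
  have fin: "finite f" "finite g"
    using K fg finite_face by auto
  have ne: "f \<noteq> {}" "g \<noteq> {}"
    using nonempty_if_neq_card_eq fin fg by blast+
  have m: "m \<in> f"
    using fin ne by (simp add: m_def)
  have "\<not> g \<subseteq> f"
    using card_subset_eq[of f g] fin fg by auto
  then obtain x where x: "x \<in> g" "x \<notin> f"
    by blast
  have "x \<noteq> m" "x \<le> m"
    using x m fin fg(5) by (auto simp: m_def)
  then have xm: "x < m"
    by simp
  \<comment> \<open>The bound comes from \<open>x \<in> g\<close>; it becomes strict because
    \<open>Min f\<close> lies in \<open>f\<close> and \<open>x\<close> does not.\<close>
  have "Min f \<le> x"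
    using x fin fg(6) by (meson Min_le order_trans)
  moreover have "Min f \<noteq> x"
    using x(2) Min_in[OF fin(1) ne(1)] by blast
  ultimately have minf: "Min f < x"
    by simp
  define h where "h = insert x (f - {m})"
  obtain F where F: "facet K F" "f \<subseteq> F"
    using ex_facet_superset[OF K(1) fg(1)] .
  then have FK: "F \<in> K"
    by (simp add: facet_def)
  have finF: "finite F"
    using K(1) FK finite_face by auto
  have "h \<in> K"
  proof (cases "x \<in> F")
    case True
    then have "h \<subseteq> F"
      using F(2) by (auto simp: h_def)
    then show ?thesis
      using K(1) FK face_subset by blast
  next
    case False
    \<comment> \<open>The exchange takes place in the facet, where \<open>m\<close> need not be the
      maximum; heredity then cuts \<open>G\<close> down to \<open>h\<close>.\<close>
    define G where "G = insert x (F - {m})"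
    have mF: "m \<in> F"
      using m F(2) by blast
    have minF: "Min F < x"
      using minf Min_antimono[OF F(2) ne(1) finF] by simp
    have "Min G = Min F"
    proof (rule Min_eqI)
      show "finite G" using finF by (simp add: G_def)
      show "Min F \<le> y" if "y \<in> G" for y
        using that minF finF by (auto simp: G_def)
      \<comment> \<open>Since \<open>Min F < x < m\<close>, the minimum of \<open>F\<close> survives
        the removal of \<open>m\<close>.\<close>
      have "Min F \<in> F" using Min_in[OF finF] mF by blast
      then show "Min F \<in> G" using minF xm by (simp add: G_def)
    qed
    moreover have "G \<subseteq> V"
      using K(2) FK fg(2) x(1) by (auto simp: G_def)
    moreover have "card G = card F"
      using card_insert_Diff_eq[OF finF mF False] by (simp add: G_def)
    moreover have "componentwise_le G F"
      using componentwise_le_exchange[OF finF mF False] xm by (simp add: G_def)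
    ultimately have "G \<in> K"
      using underclosed F(1) by blast
    moreover have "h \<subseteq> G"
      using F(2) by (auto simp: G_def h_def)
    ultimately show ?thesis
      using K(1) face_subset by blast
  qed
  moreover have "card h = card f"
    using card_insert_Diff_eq[OF fin(1) m x(2)] by (simp add: h_def)
  moreover have "h \<subseteq> (f \<union> g) - {Max f}"
    using x xm by (auto simp: h_def m_def)
  ultimately show ?thesis
    by blast
qed

theorem theorem5:
  fixes \<Delta> :: "'a set set"
  assumes "abstract_simplicial_complex \<Delta>"
  shows "(unit_interval_complex \<Delta> \<longrightarrow> skeleton_E_chordal \<Delta>) \<and>
         (underclosed_complex \<Delta> \<longrightarrow> skeleton_weakly_chordal \<Delta>)"
proof (intro conjI impI)
  assume "unit_interval_complex \<Delta>"
  then obtain l where l: "vertex_labeling \<Delta> l"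
    and interval: "\<forall>F. facet (relabel l \<Delta>) F \<longrightarrow>
      (\<forall>G. G \<subseteq> {Min F..Max F} \<and> card G = card F \<longrightarrow> G \<in> relabel l \<Delta>)"
    unfolding unit_interval_complex_def by blast
  note faces = unit_interval_faces[OF abstract_simplicial_complex_relabel[OF assms] interval]
  have "h \<in> relabel l \<Delta>"
    if "f \<in> relabel l \<Delta>" "g \<in> relabel l \<Delta>" "f \<noteq> g" "card f = card g" "Max f = Max g"
      "h \<subseteq> f \<union> g" "card h = card f" for f g h
  \<comment> \<open>As sizes and maxima agree, the claim is symmetric in \<open>f\<close> and
    \<open>g\<close>, so the face with the smaller minimum may come first.\<close>
  proof (cases "Min f \<le> Min g")
    case True
    with that show ?thesis using faces[of f g h] by simp
  next
    case False
    with that show ?thesis using faces[of g f h] by (simp add: Un_commute)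
  qed
  with l show "skeleton_E_chordal \<Delta>"
    unfolding skeleton_E_chordal_def by blast
next
  assume "underclosed_complex \<Delta>"
  then obtain l where l: "vertex_labeling \<Delta> l"
    and underclosed: "\<forall>F. facet (relabel l \<Delta>) F \<longrightarrow>
      (\<forall>G. G \<subseteq> {1..card (vertices \<Delta>)} \<and> card G = card F \<and>
           Min G = Min F \<and> componentwise_le G F \<longrightarrow> G \<in> relabel l \<Delta>)"
    unfolding underclosed_complex_def by blast
  have "\<Union>(relabel l \<Delta>) \<subseteq> {1..card (vertices \<Delta>)}"
    using relabel_subset_labels[OF l] by blast
  note exchange = underclosed_exchange_face[OF abstract_simplicial_complex_relabel[OF assms]
      this underclosed]
  have "\<exists>h\<in>relabel l \<Delta>. card h = card f \<and> h \<subseteq> (f \<union> g) - {Max f}"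
    if "f \<in> relabel l \<Delta>" "g \<in> relabel l \<Delta>" "f \<noteq> g" "card f = card g" "Max f = Max g" for f g
  proof (cases "Min f \<le> Min g")
    case True
    with that show ?thesis using exchange[of f g] by simp
  next
    case False
    with that show ?thesis using exchange[of g f] by (simp add: Un_commute)
  qed
  with l show "skeleton_weakly_chordal \<Delta>"
    unfolding skeleton_weakly_chordal_def by blast
qed

end
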